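(* Let $E$ be a finite nonempty set, let $\mathscr{H}=(E,\mathcal{H})$ be a simple hereditary collection with a boolean representation $A$, and let $A'$ be the matrix obtained from $A$ by the construction described in the context. Then: (a) The rows of $A'$ form a lattice $\operatorname{Lat}(A')$ under sup and the determined meet, which is sup-generated by the rows of $A'$. (b) The independent subsets of $A$ and $A'$ are the same: for every $J\subseteq E$, the columns of $A$ indexed by $J$ are independent if and only if the columns of $A'$ indexed by $J$ are independent. (c) The map $r\mapsto r^{(0)}$ is an order-reversing isomorphism from $\operatorname{Lat}(A')$ to $\operatorname{cl}(A')$. (d) The partial cross sections of the partitions of $\operatorname{cl}(A')$ give exactly $\mathcal{H}$: a subset $J\subseteq E$ belongs to $\mathcal{H}$ if and only if $J$ is a partial cross section of the partition associated with some maximal chain of $\operatorname{cl}(A')$ from $\emptyset$ to $E$.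
   Context: A hereditary collection $\mathscr{H}=(E,\mathcal{H})$ consists of a set $E$ and a nonempty collection $\mathcal{H}$ of subsets of $E$ such that $J'\subseteq J\in\mathcal{H}$ implies $J'\in\mathcal{H}$. Members of $\mathcal{H}$ are called independent, other subsets dependent; a circuit is a minimal dependent subset. $\mathscr{H}$ is simple if it has no circuits with $1$ or $2$ elements. The superboolean semiring is $\mathbb{SB}=\{0,1,1^\nu\}$ with commutative operations: $0+x=x$ for all $x$, $1+1=1+1^\nu=1^\nu+1^\nu=1^\nu$; $0\cdot x=0$, $1\cdot x=x$, $1^\nu\cdot 1^\nu=1^\nu$. Vectors $v_1,\dots,v_m\in\mathbb{SB}^{n}$ are dependent if there are $\alpha_1,\dots,\alpha_m\in\{0,1\}$, not all $0$, with $\alpha_1v_1+\cdots+\alpha_mv_m\in\{0,1^\nu\}^{n}$; otherwise they are independent. A boolean representation of $\mathscr{H}$ is a matrix $A$ with entries in $\{0,1\}\subseteq\mathbb{SB}$ and columns indexed by $E$, such that for every $J\subseteq E$: $J\in\mathcal{H}$ if and only if the columns of $A$ indexed by $J$ are independent. Construction of $A'$: first augment the rows of $A$ by all rows in $\{0,1\}^E$ having exactly one entry $0$ and all other entries $1$; call the result $B$. Then augment $B$ by the sups (entrywise maxima) of all subsets of rows of $B$, including the empty subset, whose sup is the zero row; call the result $A'$. Rows are ordered entrywise (with $0<1$), and equal rows are identified, so $\operatorname{Lat}(A')$ is the set of distinct rows of $A'$ with this order. "Determined meet" of two rows means the sup of all rows of $A'$ lying below both. For a row $r$ of $A'$ put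 $r^{(0)}:=\{e\in E: r_e=0\}$, and let $\operatorname{cl}(A'):=\{r^{(0)}: r \text{ a row of } A'\}$, ordered by inclusion. It is closed under intersections and contains $\emptyset$ and $E$; it is a lattice whose meet is intersection, the join of $X,Y$ being the intersection of all members of $\operatorname{cl}(A')$ containing $X\cup Y$. A maximal chain $\emptyset=C_k\subsetneq C_{k-1}\subsetneq\cdots\subsetneq C_1\subsetneq C_0=E$ in $\operatorname{cl}(A')$ has the associated partition of $E$ with blocks $C_{j-1}\setminus C_j$, $j=1,\dots,k$. A subset $J\subseteq E$ is a partial cross section of a partition if it meets each block in at most one element. *)

theory Defs
  imports Main "HOL-Library.FuncSet" "HOL-Algebra.Lattice"
begin

datatype superbool = SB0 | SB1 | SB1nu

instantiation superbool :: comm_semiring_1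
begin

definition zero_superbool :: superbool where "0 = SB0"
definition one_superbool :: superbool where "1 = SB1"

definition plus_superbool :: "superbool \<Rightarrow> superbool \<Rightarrow> superbool" where
  "x + y = (if x = SB0 then y else if y = SB0 then x else SB1nu)"

definition times_superbool :: "superbool \<Rightarrow> superbool \<Rightarrow> superbool" where
  "x * y = (if x = SB0 \<or> y = SB0 then SB0
            else if x = SB1 then y else if y = SB1 then x else SB1nu)"

instance
proof
  fix a b c :: superbool
  show "a + b + c = a + (b + c)" "a + b = b + a" "0 + a = a"
    "a * b * c = a * (b * c)" "a * b = b * a" "1 * a = a" "0 * a = 0" "a * 0 = 0"
    "(a + b) * c = a * c + b * c" "(0::superbool) \<noteq> 1"
    by (cases a; cases b; cases c;
        simp add: zero_superbool_def one_superbool_def plus_superbool_def times_superbool_def)+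
qed

end

text \<open>Only the part \<open>0 < 1\<close> of this order is used: the matrices below have entries in
  \<open>{0, 1}\<close>.\<close>

primrec superbool_rank :: "superbool \<Rightarrow> nat" where
  "superbool_rank SB0 = 0"
| "superbool_rank SB1 = 1"
| "superbool_rank SB1nu = 2"

instantiation superbool :: linorder
begin

definition less_eq_superbool :: "superbool \<Rightarrow> superbool \<Rightarrow> bool" where
  "x \<le> y \<longleftrightarrow> superbool_rank x \<le> superbool_rank y"

definition less_superbool :: "superbool \<Rightarrow> superbool \<Rightarrow> bool" where
  "x < y \<longleftrightarrow> superbool_rank x < superbool_rank y"

instance
proof
  fix x y z :: superbool
  show "(x < y) = (x \<le> y \<and> \<not> y \<le> x)" "x \<le> x" "x \<le> y \<or> y \<le> x"
    by (auto simp: less_eq_superbool_def less_superbool_def)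
  show "x \<le> y \<Longrightarrow> y \<le> z \<Longrightarrow> x \<le> z"
    by (simp add: less_eq_superbool_def)
  show "x \<le> y \<Longrightarrow> y \<le> x \<Longrightarrow> x = y"
    by (cases x; cases y; simp add: less_eq_superbool_def)
qed

end

definition hereditary_collection :: "'e set \<Rightarrow> 'e set set \<Rightarrow> bool" where
  "hereditary_collection E H \<longleftrightarrow>
     H \<subseteq> Pow E \<and> H \<noteq> {} \<and> (\<forall>J\<in>H. \<forall>J'. J' \<subseteq> J \<longrightarrow> J' \<in> H)"

definition circuit :: "'e set \<Rightarrow> 'e set set \<Rightarrow> 'e set \<Rightarrow> bool" where
  "circuit E H C \<longleftrightarrow> C \<subseteq> E \<and> C \<notin> H \<and> (\<forall>C'. C' \<subset> C \<longrightarrow> C' \<in> H)"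

definition simple_collection :: "'e set \<Rightarrow> 'e set set \<Rightarrow> bool" where
  "simple_collection E H \<longleftrightarrow>
     hereditary_collection E H \<and> \<not> (\<exists>C. circuit E H C \<and> card C \<in> {1, 2})"

text \<open>A matrix is given by a set \<open>I\<close> of row indices and its entries \<open>A i e\<close> for \<open>i \<in> I\<close>
  and \<open>e\<close> in the set \<open>E\<close> of column indices. The columns indexed by \<open>J\<close> are regarded as a
  family, so equal columns with different indices count separately.\<close>

definition columns_dependent :: "'i set \<Rightarrow> ('i \<Rightarrow> 'e \<Rightarrow> superbool) \<Rightarrow> 'e set \<Rightarrow> bool" where
  "columns_dependent I A J \<longleftrightarrow>
     (\<exists>\<alpha> :: 'e \<Rightarrow> superbool.
        (\<forall>e\<in>J. \<alpha> e \<in> {0, 1}) \<and> (\<exists>e\<in>J. \<alpha> e \<noteq> 0) \<and>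
        (\<forall>i\<in>I. (\<Sum>e\<in>J. \<alpha> e * A i e) \<in> {0, SB1nu}))"

definition columns_independent :: "'i set \<Rightarrow> ('i \<Rightarrow> 'e \<Rightarrow> superbool) \<Rightarrow> 'e set \<Rightarrow> bool" where
  "columns_independent I A J \<longleftrightarrow> \<not> columns_dependent I A J"

definition boolean_representation ::
    "'e set \<Rightarrow> 'e set set \<Rightarrow> 'i set \<Rightarrow> ('i \<Rightarrow> 'e \<Rightarrow> superbool) \<Rightarrow> bool" where
  "boolean_representation E H I A \<longleftrightarrow>
     finite I \<and> (\<forall>i\<in>I. \<forall>e\<in>E. A i e \<in> {0, 1}) \<and>
     (\<forall>J. J \<subseteq> E \<longrightarrow> (J \<in> H \<longleftrightarrow> columns_independent I A J))"

text \<open>Rows are extensional functions on \<open>E\<close>, so that rows which agree on \<open>E\<close> are equal.\<close>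

definition matrix_rows :: "'e set \<Rightarrow> 'i set \<Rightarrow> ('i \<Rightarrow> 'e \<Rightarrow> superbool) \<Rightarrow> ('e \<Rightarrow> superbool) set"
  where "matrix_rows E I A = (\<lambda>i. restrict (A i) E) ` I"

definition zero_set :: "'e set \<Rightarrow> ('e \<Rightarrow> superbool) \<Rightarrow> 'e set" where
  "zero_set E r = {e \<in> E. r e = 0}"

definition one_zero_rows :: "'e set \<Rightarrow> ('e \<Rightarrow> superbool) set" where
  "one_zero_rows E = {r \<in> E \<rightarrow>\<^sub>E {0, 1}. card (zero_set E r) = 1}"

definition B_rows :: "'e set \<Rightarrow> 'i set \<Rightarrow> ('i \<Rightarrow> 'e \<Rightarrow> superbool) \<Rightarrow> ('e \<Rightarrow> superbool) set" where
  "B_rows E I A = matrix_rows E I A \<union> one_zero_rows E"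

text \<open>The inserted \<open>0\<close> is neutral for nonempty \<open>S\<close> and yields the zero row for \<open>S = {}\<close>.\<close>

definition row_sup :: "'e set \<Rightarrow> ('e \<Rightarrow> superbool) set \<Rightarrow> ('e \<Rightarrow> superbool)" where
  "row_sup E S = (\<lambda>e\<in>E. Max (insert 0 ((\<lambda>r. r e) ` S)))"

text \<open>The matrix \<open>A'\<close> has no repeated rows, so it is identified with its set of rows; as an
  indexed matrix it has the index set \<open>A'_rows E I A\<close> and the entries \<open>\<lambda>r. r\<close>.\<close>

definition A'_rows :: "'e set \<Rightarrow> 'i set \<Rightarrow> ('i \<Rightarrow> 'e \<Rightarrow> superbool) \<Rightarrow> ('e \<Rightarrow> superbool) set" where
  "A'_rows E I A = B_rows E I A \<union> {row_sup E S | S. S \<subseteq> B_rows E I A}"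

definition row_le :: "'e set \<Rightarrow> ('e \<Rightarrow> superbool) \<Rightarrow> ('e \<Rightarrow> superbool) \<Rightarrow> bool" where
  "row_le E r s \<longleftrightarrow> (\<forall>e\<in>E. r e \<le> s e)"

definition Lat :: "'e set \<Rightarrow> ('e \<Rightarrow> superbool) set \<Rightarrow> ('e \<Rightarrow> superbool) gorder" where
  "Lat E R = \<lparr>carrier = R, eq = (=), le = row_le E\<rparr>"

definition determined_meet ::
    "'e set \<Rightarrow> ('e \<Rightarrow> superbool) set \<Rightarrow> ('e \<Rightarrow> superbool) \<Rightarrow> ('e \<Rightarrow> superbool) \<Rightarrow> 'e \<Rightarrow> superbool"
  where "determined_meet E R r s = row_sup E {t \<in> R. row_le E t r \<and> row_le E t s}"

definition cl :: "'e set \<Rightarrow> ('e \<Rightarrow> superbool) set \<Rightarrow> 'e set set" where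
  "cl E R = zero_set E ` R"

definition cl_order :: "'e set \<Rightarrow> ('e \<Rightarrow> superbool) set \<Rightarrow> 'e set gorder" where
  "cl_order E R = \<lparr>carrier = cl E R, eq = (=), le = (\<subseteq>)\<rparr>"

definition sup_generated_by :: "('a, 'b) gorder_scheme \<Rightarrow> 'a set \<Rightarrow> bool" where
  "sup_generated_by L G \<longleftrightarrow>
     G \<subseteq> carrier L \<and> (\<forall>x\<in>carrier L. \<exists>S. S \<subseteq> G \<and> least L x (Upper L S))"

definition order_reversing_iso ::
    "('a, 'c) gorder_scheme \<Rightarrow> ('b, 'd) gorder_scheme \<Rightarrow> ('a \<Rightarrow> 'b) \<Rightarrow> bool" where
  "order_reversing_iso L M f \<longleftrightarrow>
     bij_betw f (carrier L) (carrier M) \<and>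
     (\<forall>x\<in>carrier L. \<forall>y\<in>carrier L. x \<sqsubseteq>\<^bsub>L\<^esub> y \<longleftrightarrow> f y \<sqsubseteq>\<^bsub>M\<^esub> f x)"

text \<open>\<open>C 0 = E, \<dots>, C k = {}\<close> is the strictly decreasing enumeration of a maximal chain of
  \<open>F\<close>; values \<open>C j\<close> with \<open>j > k\<close> are irrelevant.\<close>

definition maximal_chain :: "'e set \<Rightarrow> 'e set set \<Rightarrow> nat \<Rightarrow> (nat \<Rightarrow> 'e set) \<Rightarrow> bool" where
  "maximal_chain E F k C \<longleftrightarrow>
     C 0 = E \<and> C k = {} \<and> (\<forall>j<k. C (Suc j) \<subset> C j) \<and> subset.maxchain F (C ` {..k})"

definition chain_partition :: "nat \<Rightarrow> (nat \<Rightarrow> 'e set) \<Rightarrow> 'e set set" where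
  "chain_partition k C = {C (j - 1) - C j | j. j \<in> {1..k}}"

definition partial_cross_section :: "'e set \<Rightarrow> 'e set set \<Rightarrow> 'e set \<Rightarrow> bool" where
  "partial_cross_section E P J \<longleftrightarrow> J \<subseteq> E \<and> (\<forall>b\<in>P. card (J \<inter> b) \<le> 1)"

end

theory Submission
  imports Defs
begin

text \<open>Everything is read off from the zero sets of rows. A set \<open>J\<close> of columns is independent if
  and only if every nonempty \<open>K \<subseteq> J\<close> has a row whose zero set contains all of \<open>K\<close> but one element
  (\<open>columns_independent_iff_witnesses\<close>). Call such a row a witness for \<open>K\<close>.

  Rows with entries \<open>0\<close> and \<open>1\<close> are determined by their zero sets, with the order reversed, and a
  sup of rows has the intersection of their zero sets as its zero set. The rows of \<open>A'\<close> are exactly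
  the sups of sets of rows of \<open>B\<close>, hence closed under sups, so that they form a lattice in which the
  meet is the sup of the common lower bounds; the dual family of zero sets is closed under
  intersection.

  Passing from \<open>A\<close> to \<open>A'\<close> keeps independence (\<open>columns_independent_A'_iff\<close>): if a sup of rows is a
  witness, so is one of these rows, and a row with a single \<open>0\<close> can be a witness only for sets with
  at most two elements, which are independent in \<open>A\<close> since the collection is simple.

  The partition statement concerns only the family of zero sets
  (\<open>witnesses_iff_partial_cross_section\<close>). Given a chain whose partition has \<open>J\<close> as a partial cross
  section, the first member of the chain that fails to contain \<open>K\<close> misses just one element of \<open>K\<close>,
  so it gives a witness. Given witnesses, successive intersections of their zero sets remove the
  elements of \<open>J\<close> one at a time; they form a chain that separates the points of \<open>J\<close>, and every
  maximal chain containing it still does.\<close>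


section \<open>Witnesses for independence\<close>

text \<open>Adding a summand \<open>1\<close> gives \<open>1\<close> only if the previous sum is \<open>0\<close>; therefore the induction
  has to carry both equivalences.\<close>

lemma superbool_sum_zero_one:
  fixes f :: "'e \<Rightarrow> superbool"
  assumes "finite K" and "\<forall>e\<in>K. f e \<in> {0, 1}"
  shows "(sum f K = 0 \<longleftrightarrow> (\<forall>e\<in>K. f e = 0)) \<and>
    (sum f K = 1 \<longleftrightarrow> (\<exists>e. {x \<in> K. f x \<noteq> 0} = {e}))"
  using assms
proof (induction K rule: finite_induct)
  case empty
  then show ?case by (simp add: zero_superbool_def one_superbool_def)
next
  case (insert a K)
  have add_zero: "x + y = 0 \<longleftrightarrow> x = 0 \<and> y = 0"
    and add_one: "x + y = 1 \<longleftrightarrow> x = 1 \<and> y = 0 \<or> x = 0 \<and> y = 1" for x y :: superbool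
    by (cases x; cases y; simp add: zero_superbool_def one_superbool_def plus_superbool_def)+
  have zero_ne_one: "(0 :: superbool) \<noteq> 1" by simp
  have IH: "(sum f K = 0 \<longleftrightarrow> (\<forall>e\<in>K. f e = 0)) \<and>
      (sum f K = 1 \<longleftrightarrow> (\<exists>e. {x \<in> K. f x \<noteq> 0} = {e}))"
    using insert by simp
  have support: "{x \<in> insert a K. f x \<noteq> 0} =
      (if f a = 0 then {x \<in> K. f x \<noteq> 0} else insert a {x \<in> K. f x \<noteq> 0})"
    by auto
  have "f a = 0 \<or> f a = 1" using insert.prems by simp
  then show ?case
  proof
    assume "f a = 0"
    then show ?thesis using IH insert.hyps support by simp
  next
    assume a: "f a = 1"
    have "(\<exists>e. insert a {x \<in> K. f x \<noteq> 0} = {e}) \<longleftrightarrow> {x \<in> K. f x \<noteq> 0} = {}"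
      using insert.hyps by blast
    then show ?thesis
      using a IH insert.hyps support zero_ne_one add_zero add_one by auto
  qed
qed

text \<open>The coefficients of a dependence select a nonempty \<open>K \<subseteq> J\<close>, and a sum of zeros and ones
  lies outside \<open>{0, 1\<^sup>\<nu>}\<close> exactly when a single summand is \<open>1\<close>. So independence of \<open>J\<close> means
  that every nonempty \<open>K \<subseteq> J\<close> has a witness: a row whose zero set contains all of \<open>K\<close> but one
  element. All later arguments use independence in this form, in which superboolean arithmetic
  no longer occurs.\<close>

lemma columns_independent_iff_witnesses:
  fixes E :: "'e set"
  assumes "finite J" and "J \<subseteq> E" and bool: "\<forall>i\<in>I. \<forall>e\<in>E. A i e \<in> {0, 1}"
  shows "columns_independent I A J \<longleftrightarrow>
    (\<forall>K\<subseteq>J. K \<noteq> {} \<longrightarrow> (\<exists>i\<in>I. \<exists>e. K - zero_set E (A i) = {e}))"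
proof -
  have not_one: "x \<in> {0, SB1nu} \<longleftrightarrow> x \<noteq> 1" for x :: superbool
    by (cases x) (simp_all add: zero_superbool_def one_superbool_def)
  have sum_iff: "(\<Sum>e\<in>J. \<alpha> e * A i e) \<in> {0, SB1nu} \<longleftrightarrow>
      \<not> (\<exists>e. {x \<in> J. \<alpha> x \<noteq> 0} - zero_set E (A i) = {e})"
    if i: "i \<in> I" and \<alpha>: "\<forall>e\<in>J. \<alpha> e \<in> {0, 1}" for i \<alpha>
  proof -
    have "\<forall>e\<in>J. \<alpha> e * A i e \<in> {0, 1}"
      using i \<alpha> bool \<open>J \<subseteq> E\<close> by fastforce
    moreover have "{x \<in> J. \<alpha> x * A i x \<noteq> 0} = {x \<in> J. \<alpha> x \<noteq> 0} - zero_set E (A i)"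
      using i \<alpha> bool \<open>J \<subseteq> E\<close> by (fastforce simp: zero_set_def)
    ultimately show ?thesis
      using superbool_sum_zero_one[OF \<open>finite J\<close>, of "\<lambda>e. \<alpha> e * A i e"]
      unfolding not_one by simp
  qed
  have "columns_dependent I A J \<longleftrightarrow>
    (\<exists>K\<subseteq>J. K \<noteq> {} \<and> (\<forall>i\<in>I. \<not> (\<exists>e. K - zero_set E (A i) = {e})))" (is "?D \<longleftrightarrow> ?W")
  proof
    assume ?D
    then obtain \<alpha> :: "'e \<Rightarrow> superbool" where \<alpha>: "\<forall>e\<in>J. \<alpha> e \<in> {0, 1}" "\<exists>e\<in>J. \<alpha> e \<noteq> 0"
      "\<forall>i\<in>I. (\<Sum>e\<in>J. \<alpha> e * A i e) \<in> {0, SB1nu}"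
      unfolding columns_dependent_def by blast
    have "\<forall>i\<in>I. \<not> (\<exists>e. {x \<in> J. \<alpha> x \<noteq> 0} - zero_set E (A i) = {e})"
      using \<alpha>(3) sum_iff[OF _ \<alpha>(1)] by blast
    then show ?W using \<alpha>(2) by (intro exI[of _ "{x \<in> J. \<alpha> x \<noteq> 0}"]) auto
  next
    assume ?W
    then obtain K where K: "K \<subseteq> J" "K \<noteq> {}"
      "\<forall>i\<in>I. \<not> (\<exists>e. K - zero_set E (A i) = {e})" by blast
    define \<alpha> :: "'e \<Rightarrow> superbool" where "\<alpha> e = (if e \<in> K then 1 else 0)" for e
    have \<alpha>01: "\<forall>e\<in>J. \<alpha> e \<in> {0, 1}" by (simp add: \<alpha>_def)
    have supp: "{x \<in> J. \<alpha> x \<noteq> 0} = K" using K(1) by (auto simp: \<alpha>_def)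
    have "\<forall>i\<in>I. (\<Sum>e\<in>J. \<alpha> e * A i e) \<in> {0, SB1nu}"
      using K(3) sum_iff[OF _ \<alpha>01] unfolding supp by blast
    moreover have "\<exists>e\<in>J. \<alpha> e \<noteq> 0" using K(1,2) supp by blast
    ultimately show ?D unfolding columns_dependent_def using \<alpha>01 by blast
  qed
  then show ?thesis unfolding columns_independent_def by blast
qed


section \<open>Boolean rows and their zero sets\<close>

lemma zero_set_subset: "zero_set E r \<subseteq> E"
  by (auto simp: zero_set_def)

lemma row_sup_singleton:
  assumes "r \<in> E \<rightarrow>\<^sub>E {0, 1 :: superbool}"
  shows "row_sup E {r} = r"
proof
  fix e
  have "max 0 x = x" for x :: superbool
    by (simp add: max_def less_eq_superbool_def zero_superbool_def)
  then show "row_sup E {r} e = r e"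
    using assms by (cases "e \<in> E") (simp_all add: row_sup_def PiE_arb[OF assms])
qed

lemma row_sup_boolean:
  assumes "finite E" and S: "S \<subseteq> E \<rightarrow>\<^sub>E {0, 1}"
  shows "row_sup E S \<in> E \<rightarrow>\<^sub>E {0, 1}"
    and "zero_set E (row_sup E S) = {e \<in> E. \<forall>r\<in>S. r e = 0}"
proof -
  have "finite S" using S \<open>finite E\<close> by (rule finite_subset[OF _ finite_PiE]) simp_all
  then have fin: "finite (insert 0 ((\<lambda>r. r e) ` S))" for e by simp
  have vals: "insert 0 ((\<lambda>r. r e) ` S) \<subseteq> {0, 1}" if "e \<in> E" for e
    using S that by (auto dest: PiE_mem)
  have "row_sup E S e \<in> {0, 1}" if "e \<in> E" for e
    using Max_in[OF fin, of e] vals[OF that] that by (auto simp: row_sup_def)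
  then show "row_sup E S \<in> E \<rightarrow>\<^sub>E {0, 1}" by (auto simp: row_sup_def)
  have le_zero: "x \<le> 0 \<longleftrightarrow> x = 0" for x :: superbool
    by (cases x) (simp_all add: less_eq_superbool_def zero_superbool_def)
  have "Max (insert 0 ((\<lambda>r. r e) ` S)) = 0 \<longleftrightarrow> (\<forall>r\<in>S. r e = 0)" for e
    using Max_le_iff[OF fin, of e 0] Max_ge[OF fin, of 0 e] by (auto simp: le_zero)
  then show "zero_set E (row_sup E S) = {e \<in> E. \<forall>r\<in>S. r e = 0}"
    by (auto simp: zero_set_def row_sup_def)
qed

lemma row_le_iff_zero_set:
  assumes "r \<in> E \<rightarrow>\<^sub>E {0, 1}" and "s \<in> E \<rightarrow>\<^sub>E {0, 1}"
  shows "row_le E r s \<longleftrightarrow> zero_set E s \<subseteq> zero_set E r"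
proof -
  have "r e \<le> s e \<longleftrightarrow> (s e = 0 \<longrightarrow> r e = 0)" if "e \<in> E" for e
    using PiE_mem[OF assms(1) that] PiE_mem[OF assms(2) that]
    by (auto simp: less_eq_superbool_def zero_superbool_def one_superbool_def)
  then show ?thesis by (auto simp: row_le_def zero_set_def)
qed

lemma inj_on_zero_set:
  fixes E :: "'e set"
  shows "inj_on (zero_set E) (E \<rightarrow>\<^sub>E {0, 1})"
proof (rule inj_onI)
  fix r s :: "'e \<Rightarrow> superbool"
  assume r: "r \<in> E \<rightarrow>\<^sub>E {0, 1}" and s: "s \<in> E \<rightarrow>\<^sub>E {0, 1}"
    and eq: "zero_set E r = zero_set E s"
  show "r = s"
  proof (rule PiE_ext[OF r s])
    fix e assume e: "e \<in> E"
    then have "r e = 0 \<longleftrightarrow> s e = 0" using eq by (auto simp: zero_set_def)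
    then show "r e = s e" using PiE_mem[OF r e] PiE_mem[OF s e] by auto
  qed
qed


section \<open>The lattice of a sup-closed set of boolean rows\<close>

lemma least_row_sup:
  assumes "finite E" and "R \<subseteq> E \<rightarrow>\<^sub>E {0, 1}" and S: "S \<subseteq> R" and sup: "row_sup E S \<in> R"
  shows "least (Lat E R) (row_sup E S) (Upper (Lat E R) S)"
proof -
  have SB: "S \<subseteq> E \<rightarrow>\<^sub>E {0, 1}" using assms by blast
  have le: "row_le E r s \<longleftrightarrow> zero_set E s \<subseteq> zero_set E r" if "r \<in> R" "s \<in> R" for r s
    using that assms(2) by (intro row_le_iff_zero_set) auto
  have "zero_set E (row_sup E S) = {e \<in> E. \<forall>r\<in>S. e \<in> zero_set E r}"
    using row_sup_boolean(2)[OF \<open>finite E\<close> SB] by (auto simp: zero_set_def)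
  moreover have "S \<inter> R = S" using S by blast
  ultimately show ?thesis
    using S sup zero_set_subset[of E]
    by (auto simp: least_def Upper_def Lat_def le subset_iff)
qed

text \<open>A lower bound of \<open>r\<close> and \<open>s\<close> is a member of the set whose sup is the determined meet, and
  this sup is itself below \<open>r\<close> and \<open>s\<close>.\<close>

lemma greatest_determined_meet:
  assumes "finite E" and R: "R \<subseteq> E \<rightarrow>\<^sub>E {0, 1}" and sup: "\<And>S. S \<subseteq> R \<Longrightarrow> row_sup E S \<in> R"
    and rs: "r \<in> R" "s \<in> R"
  shows "greatest (Lat E R) (determined_meet E R r s) (Lower (Lat E R) {r, s})"
proof -
  let ?S = "{t \<in> R. row_le E t r \<and> row_le E t s}"
  have "least (Lat E R) (row_sup E ?S) (Upper (Lat E R) ?S)"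
    using assms by (intro least_row_sup sup) auto
  then have lub: "row_sup E ?S \<in> R" "\<And>t. t \<in> ?S \<Longrightarrow> row_le E t (row_sup E ?S)"
    "\<And>u. u \<in> R \<Longrightarrow> (\<And>t. t \<in> ?S \<Longrightarrow> row_le E t u) \<Longrightarrow> row_le E (row_sup E ?S) u"
    by (auto simp: least_def Upper_def Lat_def)
  have "row_le E (row_sup E ?S) r" "row_le E (row_sup E ?S) s"
    using rs by (auto intro: lub(3))
  then show ?thesis
    using rs lub(1,2) by (auto simp: greatest_def Lower_def Lat_def determined_meet_def)
qed

lemma partial_order_Lat:
  assumes R: "R \<subseteq> E \<rightarrow>\<^sub>E {0, 1}"
  shows "partial_order (Lat E R)"
proof -
  have le: "row_le E r s \<longleftrightarrow> zero_set E s \<subseteq> zero_set E r" if "r \<in> R" "s \<in> R" for r s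
    using that R by (intro row_le_iff_zero_set) auto
  have inj: "r = s" if "r \<in> R" "s \<in> R" "zero_set E r = zero_set E s" for r s
    using inj_onD[OF inj_on_subset[OF inj_on_zero_set R]] that by blast
  show ?thesis
    by unfold_locales (auto simp: Lat_def le intro: inj)
qed

lemma lattice_Lat:
  assumes "finite E" and R: "R \<subseteq> E \<rightarrow>\<^sub>E {0, 1}" and sup: "\<And>S. S \<subseteq> R \<Longrightarrow> row_sup E S \<in> R"
  shows "lattice (Lat E R)"
    and "\<And>r s. r \<in> R \<Longrightarrow> s \<in> R \<Longrightarrow> r \<squnion>\<^bsub>Lat E R\<^esub> s = row_sup E {r, s}"
    and "\<And>r s. r \<in> R \<Longrightarrow> s \<in> R \<Longrightarrow> r \<sqinter>\<^bsub>Lat E R\<^esub> s = determined_meet E R r s"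
proof -
  have lub: "least (Lat E R) (row_sup E {r, s}) (Upper (Lat E R) {r, s})"
    if "r \<in> R" "s \<in> R" for r s
    using assms that by (intro least_row_sup sup) auto
  have glb: "greatest (Lat E R) (determined_meet E R r s) (Lower (Lat E R) {r, s})"
    if "r \<in> R" "s \<in> R" for r s
    using assms that by (intro greatest_determined_meet) auto
  interpret partial_order "Lat E R" by (rule partial_order_Lat[OF R])
  have carrier: "carrier (Lat E R) = R" by (simp add: Lat_def)
  show "lattice (Lat E R)"
    by unfold_locales (use lub glb carrier in blast)+
  show "r \<squnion>\<^bsub>Lat E R\<^esub> s = row_sup E {r, s}" if "r \<in> R" "s \<in> R" for r s
    unfolding join_def sup_def
    by (intro some_equality lub[OF that] least_unique[OF _ lub[OF that]])
  show "r \<sqinter>\<^bsub>Lat E R\<^esub> s = determined_meet E R r s" if "r \<in> R" "s \<in> R" for r s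
    unfolding meet_def inf_def
    by (intro some_equality glb[OF that] greatest_unique[OF _ glb[OF that]])
qed

lemma sup_generated_by_carrier:
  assumes "partial_order L"
  shows "sup_generated_by L (carrier L)"
proof -
  interpret partial_order L by fact
  have "least L x (Upper L {x})" if "x \<in> carrier L" for x
    using that by (auto simp: least_def Upper_def)
  then show ?thesis
    unfolding sup_generated_by_def by (meson empty_subsetI insert_subset order_refl)
qed

lemma order_reversing_iso_zero_set:
  assumes R: "R \<subseteq> E \<rightarrow>\<^sub>E {0, 1}"
  shows "order_reversing_iso (Lat E R) (cl_order E R) (zero_set E)"
proof -
  have "bij_betw (zero_set E) R (cl E R)"
    unfolding cl_def by (intro inj_on_imp_bij_betw inj_on_subset[OF inj_on_zero_set R])
  moreover have "row_le E r s \<longleftrightarrow> zero_set E s \<subseteq> zero_set E r" if "r \<in> R" "s \<in> R" for r s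
    using that R by (intro row_le_iff_zero_set) auto
  ultimately show ?thesis by (simp add: order_reversing_iso_def Lat_def cl_order_def)
qed

lemma cl_Int_closed:
  assumes "finite E" and R: "R \<subseteq> E \<rightarrow>\<^sub>E {0, 1}" and sup: "\<And>S. S \<subseteq> R \<Longrightarrow> row_sup E S \<in> R"
    and "X \<in> cl E R" and "Y \<in> cl E R"
  shows "X \<inter> Y \<in> cl E R"
proof -
  obtain r s where rs: "r \<in> R" "s \<in> R" "X = zero_set E r" "Y = zero_set E s"
    using assms(4,5) unfolding cl_def by blast
  then have "zero_set E (row_sup E {r, s}) = X \<inter> Y"
    using R by (subst row_sup_boolean(2)[OF \<open>finite E\<close>]) (auto simp: zero_set_def)
  moreover have "row_sup E {r, s} \<in> R" using rs by (intro sup) auto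
  ultimately show ?thesis unfolding cl_def by (metis imageI)
qed


section \<open>The rows of the augmented matrix\<close>

lemma B_rows_boolean:
  assumes "\<forall>i\<in>I. \<forall>e\<in>E. A i e \<in> {0, 1}"
  shows "B_rows E I A \<subseteq> E \<rightarrow>\<^sub>E {0, 1}"
proof -
  have "restrict (A i) E \<in> E \<rightarrow>\<^sub>E {0, 1}" if "i \<in> I" for i
    unfolding restrict_PiE_iff using assms that by (intro ballI) blast
  then have "matrix_rows E I A \<subseteq> E \<rightarrow>\<^sub>E {0, 1}" unfolding matrix_rows_def by blast
  then show ?thesis unfolding B_rows_def one_zero_rows_def by blast
qed

lemma A'_rows_eq_sups:
  assumes "\<forall>i\<in>I. \<forall>e\<in>E. A i e \<in> {0, 1}"
  shows "A'_rows E I A = {row_sup E S | S. S \<subseteq> B_rows E I A}"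
proof -
  have "\<exists>S. b = row_sup E S \<and> S \<subseteq> B_rows E I A" if "b \<in> B_rows E I A" for b
    using that row_sup_singleton[of b E] B_rows_boolean[OF assms]
    by (intro exI[of _ "{b}"]) auto
  then show ?thesis unfolding A'_rows_def by blast
qed

lemma A'_rows_boolean:
  assumes "finite E" and "\<forall>i\<in>I. \<forall>e\<in>E. A i e \<in> {0, 1}"
  shows "A'_rows E I A \<subseteq> E \<rightarrow>\<^sub>E {0, 1}"
  unfolding A'_rows_eq_sups[OF assms(2)]
  using row_sup_boolean(1)[OF \<open>finite E\<close>] B_rows_boolean[OF assms(2)] by blast

text \<open>A sup of sups is the sup of the union.\<close>

lemma A'_rows_sup_closed:
  assumes "finite E" and bool: "\<forall>i\<in>I. \<forall>e\<in>E. A i e \<in> {0, 1}" and "S \<subseteq> A'_rows E I A"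
  shows "row_sup E S \<in> A'_rows E I A"
proof -
  let ?B = "B_rows E I A"
  have B: "?B \<subseteq> E \<rightarrow>\<^sub>E {0, 1}" by (rule B_rows_boolean[OF bool])
  have SB: "S \<subseteq> E \<rightarrow>\<^sub>E {0, 1}"
    using assms(3) A'_rows_boolean[OF assms(1,2)] by blast
  have "\<forall>r\<in>S. \<exists>T\<subseteq>?B. r = row_sup E T"
    using assms(3) unfolding A'_rows_eq_sups[OF bool] by blast
  then obtain T where T: "\<And>r. r \<in> S \<Longrightarrow> T r \<subseteq> ?B \<and> r = row_sup E (T r)" by metis
  let ?U = "\<Union>r\<in>S. T r"
  have U: "?U \<subseteq> ?B" using T by blast
  then have UB: "?U \<subseteq> E \<rightarrow>\<^sub>E {0, 1}" using B by blast
  have zT: "{e \<in> E. r e = 0} = {e \<in> E. \<forall>b\<in>T r. b e = 0}" if "r \<in> S" for r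
  proof -
    have "zero_set E (row_sup E (T r)) = {e \<in> E. \<forall>b\<in>T r. b e = 0}"
      using T[OF that] B by (intro row_sup_boolean(2)[OF \<open>finite E\<close>]) blast
    then show ?thesis using T[OF that] by (simp add: zero_set_def)
  qed
  have "zero_set E (row_sup E S) = {e \<in> E. \<forall>r\<in>S. r e = 0}"
    by (rule row_sup_boolean(2)[OF \<open>finite E\<close> SB])
  also have "\<dots> = {e \<in> E. \<forall>b\<in>?U. b e = 0}" using zT by blast
  also have "\<dots> = zero_set E (row_sup E ?U)"
    by (rule row_sup_boolean(2)[OF \<open>finite E\<close> UB, symmetric])
  finally have "row_sup E S = row_sup E ?U"
    using inj_onD[OF inj_on_zero_set] row_sup_boolean(1)[OF \<open>finite E\<close>] SB UB by blast
  then show ?thesis using U unfolding A'_rows_eq_sups[OF bool] by blast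
qed

text \<open>A sup \<open>r\<close> of rows that is \<open>1\<close> on \<open>K\<close> only at \<open>e\<close> arises from some row \<open>b \<le> r\<close> with
  \<open>b e = 1\<close>; this \<open>b\<close> vanishes on the rest of \<open>K\<close>, because \<open>r\<close> does.\<close>

lemma A'_witness_imp_B_witness:
  assumes "finite E" and bool: "\<forall>i\<in>I. \<forall>e\<in>E. A i e \<in> {0, 1}"
    and "r \<in> A'_rows E I A" and "K \<subseteq> E" and K: "K - zero_set E r = {e}"
  shows "\<exists>b\<in>B_rows E I A. K - zero_set E b = {e}"
proof -
  obtain S where S: "S \<subseteq> B_rows E I A" "r = row_sup E S"
    using assms(3) unfolding A'_rows_eq_sups[OF bool] by blast
  have z: "zero_set E r = {e \<in> E. \<forall>b\<in>S. b e = 0}"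
    unfolding S(2)
    by (rule row_sup_boolean(2)[OF \<open>finite E\<close> subset_trans[OF S(1) B_rows_boolean[OF bool]]])
  have "e \<in> E" "e \<notin> zero_set E r" using K \<open>K \<subseteq> E\<close> by blast+
  then obtain b where b: "b \<in> S" "b e \<noteq> 0" unfolding z by blast
  have "zero_set E r \<subseteq> zero_set E b" using b(1) unfolding z by (auto simp: zero_set_def)
  moreover have "e \<notin> zero_set E b" using b(2) by (simp add: zero_set_def)
  ultimately have "K - zero_set E b = {e}" using K by blast
  then show ?thesis using b(1) S(1) by blast
qed

lemma simple_collection_small_sets:
  assumes "finite E" and simple: "simple_collection E H" and "J \<subseteq> E" and "card J \<le> 2"
  shows "J \<in> H"
proof -
  have H: "H \<noteq> {}" "\<And>J J'. J \<in> H \<Longrightarrow> J' \<subseteq> J \<Longrightarrow> J' \<in> H"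
    and no_circuit: "\<And>C. circuit E H C \<Longrightarrow> card C \<notin> {1, 2}"
    using simple by (auto simp: simple_collection_def hereditary_collection_def)
  have "{} \<in> H" using H by blast
  show ?thesis
    using assms(3,4)
  proof (induction "card J" arbitrary: J rule: less_induct)
    case less
    have "finite J" using less.prems(1) \<open>finite E\<close> finite_subset by blast
    have "C' \<in> H" if "C' \<subset> J" for C'
      using less.hyps[of C'] less.prems that psubset_card_mono[OF \<open>finite J\<close> that] by auto
    then have "J \<notin> H \<Longrightarrow> circuit E H J" using less.prems by (simp add: circuit_def)
    moreover have "card J = 0 \<or> card J \<in> {1, 2}" using less.prems(2) by auto
    moreover have "card J = 0 \<Longrightarrow> J = {}" using \<open>finite J\<close> by simp
    ultimately show ?case using no_circuit \<open>{} \<in> H\<close> by blast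
  qed
qed

text \<open>Sups create no new witnesses (\<open>A'_witness_imp_B_witness\<close>). A row with a single \<open>0\<close> can witness
  only sets \<open>K\<close> with at most two elements, and since the collection is simple these have
  witnesses in \<open>A\<close> already.\<close>

lemma columns_independent_A'_iff:
  assumes "finite E" and "simple_collection E H" and rep: "boolean_representation E H I A"
    and "J \<subseteq> E"
  shows "columns_independent (A'_rows E I A) (\<lambda>r. r) J \<longleftrightarrow> columns_independent I A J"
proof -
  have bool: "\<forall>i\<in>I. \<forall>e\<in>E. A i e \<in> {0, 1}"
    using rep by (simp add: boolean_representation_def)
  have finJ: "finite J" using \<open>J \<subseteq> E\<close> \<open>finite E\<close> finite_subset by blast
  have bool': "\<forall>r\<in>A'_rows E I A. \<forall>e\<in>E. r e \<in> {0, 1}"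
    using A'_rows_boolean[OF \<open>finite E\<close> bool] by (auto dest: PiE_mem)
  have zero_restrict: "zero_set E (restrict (A i) E) = zero_set E (A i)" for i
    by (auto simp: zero_set_def)
  have same_witnesses: "(\<exists>r\<in>A'_rows E I A. \<exists>e. K - zero_set E r = {e}) \<longleftrightarrow>
      (\<exists>i\<in>I. \<exists>e. K - zero_set E (A i) = {e})" (is "?W' \<longleftrightarrow> ?W")
    if K: "K \<subseteq> J" "K \<noteq> {}" for K
  proof
    assume ?W
    then show ?W'
      unfolding A'_rows_def B_rows_def matrix_rows_def using zero_restrict by blast
  next
    assume ?W'
    then obtain r e where r: "r \<in> A'_rows E I A" "K - zero_set E r = {e}" by blast
    have KE: "K \<subseteq> E" using K(1) \<open>J \<subseteq> E\<close> by blast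
    obtain b where b: "b \<in> B_rows E I A" "K - zero_set E b = {e}"
      using A'_witness_imp_B_witness[OF \<open>finite E\<close> bool r(1) KE r(2)] by blast
    show ?W
    proof (cases "b \<in> matrix_rows E I A")
      case True
      then obtain i where "i \<in> I" "b = restrict (A i) E" unfolding matrix_rows_def by blast
      then have "K - zero_set E (A i) = {e}" using b(2) zero_restrict by metis
      then show ?thesis using \<open>i \<in> I\<close> by blast
    next
      case False
      then have "card (zero_set E b) = 1"
        using b(1) by (simp add: B_rows_def one_zero_rows_def)
      then obtain z where "zero_set E b = {z}" by (rule card_1_singletonE)
      then have "K \<subseteq> {e, z}" using b(2) by blast
      then have "card K \<le> card {e, z}" by (rule card_mono[rotated]) simp
      also have "\<dots> \<le> 2" by (simp add: card_insert_if)
      finally have "card K \<le> 2" .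
      then have "K \<in> H"
        by (rule simple_collection_small_sets[OF assms(1,2) KE])
      then have "columns_independent I A K"
        using rep KE by (simp add: boolean_representation_def)
      then show ?thesis
        using columns_independent_iff_witnesses[OF finite_subset[OF K(1) finJ] KE bool,
            THEN iffD1, rule_format, OF _ order_refl K(2)] by blast
    qed
  qed
  show ?thesis
    unfolding columns_independent_iff_witnesses[OF finJ \<open>J \<subseteq> E\<close> bool]
      columns_independent_iff_witnesses[OF finJ \<open>J \<subseteq> E\<close> bool']
    by (intro iff_allI imp_cong refl same_witnesses)
qed

lemma ground_set_in_cl_A': "E \<in> cl E (A'_rows E I A)"
proof -
  have "row_sup E {} \<in> A'_rows E I A" unfolding A'_rows_def by blast
  moreover have "zero_set E (row_sup E {}) = E" by (auto simp: zero_set_def row_sup_def)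
  ultimately show ?thesis unfolding cl_def by (metis imageI)
qed

text \<open>The sup of all rows of \<open>A'\<close> is the all-one row, because each \<open>{e}\<close> is independent and hence
  has a row of \<open>A\<close> with a \<open>1\<close> at \<open>e\<close>.\<close>

lemma empty_in_cl_A':
  assumes "finite E" and "simple_collection E H" and rep: "boolean_representation E H I A"
  shows "{} \<in> cl E (A'_rows E I A)"
proof -
  have bool: "\<forall>i\<in>I. \<forall>e\<in>E. A i e \<in> {0, 1}"
    using rep by (simp add: boolean_representation_def)
  let ?R = "A'_rows E I A"
  have "\<exists>r\<in>?R. r e \<noteq> 0" if e: "e \<in> E" for e
  proof -
    have "{e} \<in> H" using simple_collection_small_sets[OF assms(1,2), of "{e}"] e by simp
    then have "columns_independent I A {e}"
      using rep e by (simp add: boolean_representation_def)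
    then have wit: "\<forall>K\<subseteq>{e}. K \<noteq> {} \<longrightarrow> (\<exists>i\<in>I. \<exists>e'. K - zero_set E (A i) = {e'})"
      using e bool by (intro columns_independent_iff_witnesses[THEN iffD1]) simp_all
    obtain i e' where "i \<in> I" "{e} - zero_set E (A i) = {e'}"
      using wit[rule_format, OF order_refl insert_not_empty] by blast
    then have "e \<notin> zero_set E (A i)" by (simp add: insert_Diff_if split: if_splits)
    then have "restrict (A i) E e \<noteq> 0" using e by (simp add: zero_set_def)
    moreover have "restrict (A i) E \<in> ?R"
      unfolding A'_rows_def B_rows_def matrix_rows_def using \<open>i \<in> I\<close> by blast
    ultimately show ?thesis by blast
  qed
  then have "zero_set E (row_sup E ?R) = {}"
    using row_sup_boolean(2)[OF \<open>finite E\<close> A'_rows_boolean[OF \<open>finite E\<close> bool]] by auto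
  then show ?thesis
    using A'_rows_sup_closed[OF \<open>finite E\<close> bool order_refl] unfolding cl_def by (metis imageI)
qed


section \<open>Chains and partial cross sections\<close>

lemma descending_antimono:
  assumes "\<forall>j<k. C (Suc j) \<subset> C j" and "i \<le> j" and "j \<le> k"
  shows "C j \<subseteq> C i"
  using assms(2,3)
proof (induction j rule: dec_induct)
  case (step n)
  then have "C (Suc n) \<subset> C n" using assms(1) by simp
  then show ?case using step by auto
qed simp

text \<open>Going down the chain, consider the last member \<open>C j\<close> that still contains \<open>K\<close>. The part
  of \<open>K\<close> lost in the next step lies in a block, so it is a single element.\<close>

lemma partial_cross_section_imp_witness:
  assumes "finite J" and chain: "\<forall>j<k. C (Suc j) \<subset> C j" and "C 0 = E" and "C k = {}"
    and cross: "partial_cross_section E (chain_partition k C) J" and K: "K \<subseteq> J" "K \<noteq> {}"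
  shows "\<exists>j\<le>k. \<exists>e. K - C j = {e}"
proof -
  have JE: "J \<subseteq> E" using cross by (simp add: partial_cross_section_def)
  have "\<not> K \<subseteq> C k" using K(2) \<open>C k = {}\<close> by blast
  moreover have "K \<subseteq> C 0" using K(1) JE \<open>C 0 = E\<close> by blast
  ultimately obtain j where j: "j < k" "\<not> K \<subseteq> C (Suc j)" "K \<subseteq> C j"
    using ex_least_nat_less[of "\<lambda>j. \<not> K \<subseteq> C j" k] by (metis order_refl)
  have "C j - C (Suc j) \<in> chain_partition k C"
    unfolding chain_partition_def using j(1) by (intro CollectI exI[of _ "Suc j"]) auto
  then have "card (J \<inter> (C j - C (Suc j))) \<le> 1"
    using cross by (simp add: partial_cross_section_def)
  moreover have "K - C (Suc j) \<subseteq> J \<inter> (C j - C (Suc j))" using K(1) j(3) by blast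
  ultimately have "card (K - C (Suc j)) \<le> 1"
    using card_mono[of "J \<inter> (C j - C (Suc j))" "K - C (Suc j)"] \<open>finite J\<close> by simp
  moreover have "card (K - C (Suc j)) \<noteq> 0"
    using j(2) finite_subset[OF K(1) \<open>finite J\<close>] by auto
  ultimately have "card (K - C (Suc j)) = 1" by simp
  then obtain e where "K - C (Suc j) = {e}" by (rule card_1_singletonE)
  then show ?thesis using j(1) by (intro exI[of _ "Suc j"]) auto
qed

text \<open>A witness for \<open>J\<close> splits off one element, and the rest of \<open>J\<close> lies in its zero set \<open>Z\<close>.
  Cutting a chain for the rest down to subsets of \<open>Z\<close> and adding \<open>Z\<close> on top gives a chain for
  \<open>J\<close>. Separation of the points of \<open>J\<close>, as opposed to the condition on blocks, visibly survives
  enlarging the chain.\<close>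

lemma witnesses_imp_separating_chain:
  assumes "finite J" and Int: "\<And>X Y. X \<in> F \<Longrightarrow> Y \<in> F \<Longrightarrow> X \<inter> Y \<in> F"
    and "\<forall>K\<subseteq>J. K \<noteq> {} \<longrightarrow> (\<exists>Z\<in>F. \<exists>e. K - Z = {e})"
  shows "\<exists>M. subset.chain F M \<and> (\<forall>x\<in>J. \<forall>y\<in>J. x \<noteq> y \<longrightarrow> (\<exists>D\<in>M. (x \<in> D) \<noteq> (y \<in> D)))"
  using assms(1,3)
proof (induction J rule: finite_psubset_induct)
  case (psubset J)
  show ?case
  proof (cases "J = {}")
    case True
    then show ?thesis by (intro exI[of _ "{}"]) simp
  next
    case False
    then obtain Z e where Z: "Z \<in> F" "J - Z = {e}"
      using psubset.prems[rule_format, OF order_refl] by blast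
    have "J - {e} \<subset> J" using Z(2) by blast
    moreover have "\<forall>K\<subseteq>J - {e}. K \<noteq> {} \<longrightarrow> (\<exists>Z\<in>F. \<exists>e. K - Z = {e})"
      by (intro allI impI psubset.prems[rule_format]) auto
    ultimately have "\<exists>M. subset.chain F M \<and>
        (\<forall>x\<in>J - {e}. \<forall>y\<in>J - {e}. x \<noteq> y \<longrightarrow> (\<exists>D\<in>M. (x \<in> D) \<noteq> (y \<in> D)))"
      by (rule psubset.IH)
    then obtain M where M: "subset.chain F M"
      "\<forall>x\<in>J - {e}. \<forall>y\<in>J - {e}. x \<noteq> y \<longrightarrow> (\<exists>D\<in>M. (x \<in> D) \<noteq> (y \<in> D))"
      by metis
    have in_Z: "w \<in> Z \<longleftrightarrow> w \<noteq> e" if "w \<in> J" for w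
      using Z(2) that by (metis Diff_iff singleton_iff)
    \<comment> \<open>Intersecting with \<open>Z \<supseteq> J - {e}\<close> does not change how a set separates \<open>J - {e}\<close>.\<close>
    let ?M = "insert Z ((\<lambda>D. Z \<inter> D) ` M)"
    have "subset.chain F ?M"
      using M(1) Z(1) Int unfolding subset_chain_def by (auto 0 4)
    moreover have "\<exists>D\<in>?M. (x \<in> D) \<noteq> (y \<in> D)" if "x \<in> J" "y \<in> J" "x \<noteq> y" for x y
    proof (cases "x = e \<or> y = e")
      case True
      then have "(x \<in> Z) \<noteq> (y \<in> Z)" using in_Z that by metis
      then show ?thesis by blast
    next
      case False
      then have "x \<in> J - {e}" "y \<in> J - {e}" using that by auto
      then obtain D where "D \<in> M" "(x \<in> D) \<noteq> (y \<in> D)"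
        using M(2) \<open>x \<noteq> y\<close> by metis
      moreover have "x \<in> Z" "y \<in> Z" using in_Z that False by auto
      ultimately show ?thesis by (intro bexI[of _ "Z \<inter> D"]) auto
    qed
    ultimately show ?thesis by blast
  qed
qed

lemma finite_chain_extends_to_maxchain:
  assumes "finite F" and "subset.chain F M"
  shows "\<exists>N. subset.maxchain F N \<and> M \<subseteq> N"
proof -
  have "finite {N. subset.chain F N}"
    using \<open>finite F\<close> by (rule finite_subset[rotated, OF finite_Pow_iff[THEN iffD2]])
      (auto simp: subset_chain_def)
  then obtain N where "subset.chain F N" "M \<subseteq> N"
    "\<forall>N'. subset.chain F N' \<longrightarrow> N \<subseteq> N' \<longrightarrow> N = N'"
    using finite_has_maximal2[of "{N. subset.chain F N}" M] assms(2) by auto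
  then show ?thesis unfolding subset.maxchain_def by blast
qed

lemma finite_chain_enumeration:
  assumes "finite M" and "M \<noteq> {}" and "\<forall>X\<in>M. \<forall>Y\<in>M. X \<subseteq> Y \<or> Y \<subseteq> X"
  shows "\<exists>k C. M = C ` {..k} \<and> (\<forall>j<k. C (Suc j) \<subset> (C j :: 'e set))"
  using assms
proof (induction M rule: finite_psubset_induct)
  case (psubset M)
  obtain m where m: "m \<in> M" "\<forall>X\<in>M. X \<subseteq> m \<longrightarrow> m = X"
    using finite_has_minimal[OF psubset.hyps(1) psubset.prems(1)] by blast
  then have least: "\<forall>X\<in>M. m \<subseteq> X" using psubset.prems(2) by blast
  show ?case
  proof (cases "M = {m}")
    case True
    then show ?thesis by (intro exI[of _ 0] exI[of _ "\<lambda>_. m"]) simp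
  next
    case False
    have "M - {m} \<subset> M" and "M - {m} \<noteq> {}" using False m(1) by auto
    moreover have "\<forall>X\<in>M - {m}. \<forall>Y\<in>M - {m}. X \<subseteq> Y \<or> Y \<subseteq> X"
      using psubset.prems(2) by blast
    ultimately obtain k C where C: "M - {m} = C ` {..k}" "\<forall>j<k. C (Suc j) \<subset> C j"
      using psubset.IH[of "M - {m}"] by metis
    have "C k \<in> M - {m}" unfolding C(1) by simp
    then have "m \<subset> C k" using least by blast
    moreover have "M = (C(Suc k := m)) ` {..Suc k}"
    proof -
      have "(C(Suc k := m)) ` {..Suc k} = insert m (C ` {..k})"
        unfolding atMost_Suc image_insert by (intro arg_cong2[of _ _ _ _ insert] image_cong) auto
      also have "\<dots> = M" using insert_Diff[OF m(1)] C(1) by simp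
      finally show ?thesis by (rule sym)
    qed
    ultimately show ?thesis
      using C(2) by (intro exI[of _ "Suc k"] exI[of _ "C(Suc k := m)"]) (auto simp: less_Suc_eq)
  qed
qed

text \<open>Both \<open>E\<close> and \<open>{}\<close> are comparable to all members of \<open>F\<close>, so maximality puts them into the
  chain, as its first and last member.\<close>

lemma maxchain_enumeration:
  assumes "finite F" and F: "F \<subseteq> Pow E" "E \<in> F" "{} \<in> F" and max: "subset.maxchain F N"
  shows "\<exists>k C. maximal_chain E F k C \<and> C ` {..k} = N"
proof -
  have N: "N \<subseteq> F" "\<forall>X\<in>N. \<forall>Y\<in>N. X \<subseteq> Y \<or> Y \<subseteq> X"
    using max by (auto simp: subset.maxchain_def subset_chain_def)
  have comparable: "X \<in> N" if "X \<in> F" "\<forall>Y\<in>N. X \<subseteq> Y \<or> Y \<subseteq> X" for X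
  proof (rule ccontr)
    assume "X \<notin> N"
    have "subset.chain F (insert X N)"
      using that N unfolding subset_chain_def by blast
    then show False using max \<open>X \<notin> N\<close> unfolding subset.maxchain_def by blast
  qed
  have EN: "E \<in> N" using N(1) F by (intro comparable) auto
  have empN: "{} \<in> N" using F by (intro comparable) auto
  obtain k C where C: "N = C ` {..k}" "\<forall>j<k. C (Suc j) \<subset> C j"
    using finite_chain_enumeration[of N] N finite_subset[OF N(1) \<open>finite F\<close>] EN by blast
  note anti = descending_antimono[OF C(2)]
  have "E \<subseteq> C 0" using EN anti unfolding C(1) by auto
  moreover have "C 0 \<in> N" unfolding C(1) by simp
  then have "C 0 \<subseteq> E" using N(1) F(1) by blast
  ultimately have "C 0 = E" by blast
  moreover have "C k = {}" using empN anti unfolding C(1) by auto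
  ultimately show ?thesis
    using C max by (intro exI[of _ k] exI[of _ C]) (simp add: maximal_chain_def)
qed

text \<open>A member of the chain either contains a given block or is disjoint from it, so it cannot
  separate two points of the block.\<close>

lemma separating_chain_imp_partial_cross_section:
  assumes chain: "\<forall>j<k. C (Suc j) \<subset> C j" and "J \<subseteq> E"
    and sep: "\<forall>x\<in>J. \<forall>y\<in>J. x \<noteq> y \<longrightarrow> (\<exists>i\<le>k. (x \<in> C i) \<noteq> (y \<in> C i))"
  shows "partial_cross_section E (chain_partition k C) J"
proof -
  note anti = descending_antimono[OF chain]
  have "card (J \<inter> (C (j - 1) - C j)) \<le> 1" if j: "j \<in> {1..k}" for j
  proof -
    have "x = y" if xy: "x \<in> J \<inter> (C (j - 1) - C j)" "y \<in> J \<inter> (C (j - 1) - C j)" for x y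
    proof (rule ccontr)
      assume "x \<noteq> y"
      then obtain i where i: "i \<le> k" "(x \<in> C i) \<noteq> (y \<in> C i)"
        using sep xy by (metis IntD1)
      show False
      proof (cases "i < j")
        case True
        then have "C (j - 1) \<subseteq> C i" using j by (intro anti) auto
        then show False using i(2) xy by blast
      next
        case False
        then have "C i \<subseteq> C j" using i(1) by (intro anti) auto
        then show False using i(2) xy by blast
      qed
    qed
    then have "is_singleton (J \<inter> (C (j - 1) - C j)) \<or> J \<inter> (C (j - 1) - C j) = {}"
      by (meson is_singletonI')
    then show ?thesis by (auto elim: is_singletonE)
  qed
  then show ?thesis
    using \<open>J \<subseteq> E\<close> by (auto simp: partial_cross_section_def chain_partition_def)
qed

text \<open>Here the left side is independence of \<open>J\<close> expressed through the zero sets of the rows. From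
  left to right, a chain separating \<open>J\<close> is enlarged to a maximal one; from right to left, the
  members of the chain are the zero sets of the required witnesses.\<close>

lemma witnesses_iff_partial_cross_section:
  assumes "finite E" and F: "F \<subseteq> Pow E" "E \<in> F" "{} \<in> F"
    and Int: "\<And>X Y. X \<in> F \<Longrightarrow> Y \<in> F \<Longrightarrow> X \<inter> Y \<in> F" and "J \<subseteq> E"
  shows "(\<forall>K\<subseteq>J. K \<noteq> {} \<longrightarrow> (\<exists>Z\<in>F. \<exists>e. K - Z = {e})) \<longleftrightarrow>
    (\<exists>k C. maximal_chain E F k C \<and> partial_cross_section E (chain_partition k C) J)"
    (is "?W \<longleftrightarrow> ?P")
proof -
  have finJ: "finite J" and finF: "finite F"
    using finite_subset[OF \<open>J \<subseteq> E\<close>] finite_subset[OF F(1)] \<open>finite E\<close> by simp_all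
  show ?thesis
  proof
    assume ?W
    then obtain M where M: "subset.chain F M"
      "\<forall>x\<in>J. \<forall>y\<in>J. x \<noteq> y \<longrightarrow> (\<exists>D\<in>M. (x \<in> D) \<noteq> (y \<in> D))"
      using witnesses_imp_separating_chain[OF finJ Int] by metis
    obtain N where N: "subset.maxchain F N" "M \<subseteq> N"
      using finite_chain_extends_to_maxchain[OF finF M(1)] by blast
    obtain k C where C: "maximal_chain E F k C" "C ` {..k} = N"
      using maxchain_enumeration[OF finF F N(1)] by blast
    have "\<exists>i\<le>k. (x \<in> C i) \<noteq> (y \<in> C i)" if "x \<in> J" "y \<in> J" "x \<noteq> y" for x y
    proof -
      obtain D where D: "D \<in> M" "(x \<in> D) \<noteq> (y \<in> D)"
        using M(2)[rule_format, OF \<open>x \<in> J\<close> \<open>y \<in> J\<close> \<open>x \<noteq> y\<close>] ..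
      then have "D \<in> C ` {..k}" using N(2) C(2) by blast
      then show ?thesis using D(2) by auto
    qed
    moreover have "\<forall>j<k. C (Suc j) \<subset> C j" using C(1) by (simp add: maximal_chain_def)
    ultimately have "partial_cross_section E (chain_partition k C) J"
      using \<open>J \<subseteq> E\<close>
      by (intro separating_chain_imp_partial_cross_section) simp_all
    then show ?P using C(1) by blast
  next
    assume ?P
    then obtain k C where C: "maximal_chain E F k C"
      and cross: "partial_cross_section E (chain_partition k C) J" by blast
    have "C j \<in> F" if "j \<le> k" for j
      using C that by (auto simp: maximal_chain_def subset.maxchain_def subset_chain_def)
    then show ?W
      using partial_cross_section_imp_witness[OF finJ _ _ _ cross] C
      unfolding maximal_chain_def by metis
  qed
qed


section \<open>The lattice of rows, its closure lattice and the partitions\<close>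

theorem theorem5p5:
  fixes E :: "'e set" and H :: "'e set set"
    and I :: "'i set" and A :: "'i \<Rightarrow> 'e \<Rightarrow> superbool"
  defines "A' \<equiv> A'_rows E I A"
  assumes "finite E" and "E \<noteq> {}"
    and "hereditary_collection E H" and "simple_collection E H"
    and "boolean_representation E H I A"
  shows
    "(lattice (Lat E A') \<and>
      (\<forall>r\<in>A'. \<forall>s\<in>A'. r \<squnion>\<^bsub>Lat E A'\<^esub> s = row_sup E {r, s} \<and>
                     r \<sqinter>\<^bsub>Lat E A'\<^esub> s = determined_meet E A' r s) \<and>
      sup_generated_by (Lat E A') A') \<and>
     (\<forall>J. J \<subseteq> E \<longrightarrow>
        (columns_independent I A J \<longleftrightarrow> columns_independent A' (\<lambda>r. r) J)) \<and>
     order_reversing_iso (Lat E A') (cl_order E A') (zero_set E) \<and>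
     (\<forall>J. J \<subseteq> E \<longrightarrow>
        (J \<in> H \<longleftrightarrow>
          (\<exists>k C. maximal_chain E (cl E A') k C \<and>
                 partial_cross_section E (chain_partition k C) J)))"
proof (intro conjI allI impI ballI)
  have bool: "\<forall>i\<in>I. \<forall>e\<in>E. A i e \<in> {0, 1}"
    using assms(6) by (simp add: boolean_representation_def)
  have R: "A' \<subseteq> E \<rightarrow>\<^sub>E {0, 1}"
    unfolding A'_def by (rule A'_rows_boolean[OF assms(2) bool])
  have sup: "row_sup E S \<in> A'" if "S \<subseteq> A'" for S
    using A'_rows_sup_closed[OF assms(2) bool] that unfolding A'_def by blast
  show "lattice (Lat E A')"
    and "\<And>r s. r \<in> A' \<Longrightarrow> s \<in> A' \<Longrightarrow> r \<squnion>\<^bsub>Lat E A'\<^esub> s = row_sup E {r, s}"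
    and "\<And>r s. r \<in> A' \<Longrightarrow> s \<in> A' \<Longrightarrow> r \<sqinter>\<^bsub>Lat E A'\<^esub> s = determined_meet E A' r s"
    using lattice_Lat[OF assms(2) R sup] by blast+
  show "sup_generated_by (Lat E A') A'"
    using sup_generated_by_carrier[OF partial_order_Lat[OF R]] by (simp add: Lat_def)
  show "order_reversing_iso (Lat E A') (cl_order E A') (zero_set E)"
    by (rule order_reversing_iso_zero_set[OF R])
  fix J assume J: "J \<subseteq> E"
  show same: "columns_independent I A J \<longleftrightarrow> columns_independent A' (\<lambda>r. r) J"
    unfolding A'_def using columns_independent_A'_iff[OF assms(2,5,6) J] by blast
  have "J \<in> H \<longleftrightarrow> columns_independent A' (\<lambda>r. r) J"
    using assms(6) J same by (simp add: boolean_representation_def)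
  also have "\<dots> \<longleftrightarrow> (\<forall>K\<subseteq>J. K \<noteq> {} \<longrightarrow> (\<exists>r\<in>A'. \<exists>e. K - zero_set E r = {e}))"
    using R by (intro columns_independent_iff_witnesses finite_subset[OF J assms(2)] J)
      (auto dest: PiE_mem)
  also have "\<dots> \<longleftrightarrow> (\<forall>K\<subseteq>J. K \<noteq> {} \<longrightarrow> (\<exists>Z\<in>cl E A'. \<exists>e. K - Z = {e}))"
    by (simp add: cl_def)
  also have "\<dots> \<longleftrightarrow> (\<exists>k C. maximal_chain E (cl E A') k C \<and>
      partial_cross_section E (chain_partition k C) J)"
  proof (rule witnesses_iff_partial_cross_section[OF assms(2) _ _ _ _ J])
    show "cl E A' \<subseteq> Pow E" by (auto simp: cl_def zero_set_def)
    show "E \<in> cl E A'" unfolding A'_def by (rule ground_set_in_cl_A')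
    show "{} \<in> cl E A'" unfolding A'_def by (rule empty_in_cl_A'[OF assms(2,5,6)])
    show "X \<inter> Y \<in> cl E A'" if "X \<in> cl E A'" "Y \<in> cl E A'" for X Y
      using cl_Int_closed[OF assms(2) R sup] that by blast
  qed
  finally show "J \<in> H \<longleftrightarrow> (\<exists>k C. maximal_chain E (cl E A') k C \<and>
      partial_cross_section E (chain_partition k C) J)" .
qed

end
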